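(* Let $(X(\cdot),u(\cdot))$, defined on $[0,t_f]$, be an optimal solution of the landing problem with atmosphere (PA) described in the context, assume $Tu_{min}\ge\sigma$, and let $\Psi$ be the associated switching function. Then the control is in the Max-Min-Max or the Max-Singular-Max form, i.e. there exist $t_1,t_2$ with $0\le t_1\le t_2\le t_f$ such that $\|u(t)\|=u_{max}$ for almost every $t\in[0,t_1)\cup(t_2,t_f]$, and on $[t_1,t_2]$ one of the following holds: either $\|u(t)\|=u_{min}$ for almost every $t\in[t_1,t_2]$, or the control is singular on $[t_1,t_2]$, meaning $\Psi(t)=0$ for all $t\in[t_1,t_2]$.
   Context: Landing problem with atmosphere (PA). Constants: $T>0$, $\sigma>0$ (effect of a constant atmospheric pressure on the thrust), $q\ge0$, $g_0>0$, $g=(0,0,g_0)$, $m_0>m_e>0$, $0\le u_{min}\le u_{max}\le1$, initial data $r_0,v_0\in\mathbb{R}^3$, and a final cost function $\ell(t,X)$. The state is $X=(r,v,m)\in\mathbb{R}^3\times\mathbb{R}^3\times\mathbb{R}$ with $r=(x,y,z)$. Minimize $\ell(t_f,X(t_f))$ over free final times $t_f$ and measurable controls $u:[0,t_f]\to\mathbb{R}^3$ such that $\dot r=v$, $\dot v=\left(T-\frac{\sigma}{\|u\|}\right)\frac{u}{m}-g$, $\dot m=-q\|u\|$; $(r,v,m)(0)=(r_0,v_0,m_0)$; $z(t_f)=0$, $v_z(t_f)=0$; $m(t)>m_e$ on $[0,t_f)$; $u(t)\in\mathcal U=\{w\in\mathbb{R}^3:u_{min}\le\|w\|\le u_{max}\}$.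 There is no pointing constraint and no state constraint. Adjoint vector. Let $H(X,P,u,p^0)=\langle p_r,v\rangle+\left\langle p_v,\left(T-\frac{\sigma}{\|u\|}\right)\frac um-g\right\rangle-p_mq\|u\|$. An optimal solution on $[0,t_f]$ comes with multipliers given by the Pontryagin maximum principle: $p^0\in\{0,-1\}$ and an absolutely continuous $P=(p_r,p_v,p_m)$ with $(P,p^0)\neq(0,0)$ such that (a) for a.e. $t$: $\dot p_r=0$, $\dot p_v=-p_r$, $\dot p_m=\frac1{m^2}\left\langle p_v,\left(T-\frac{\sigma}{\|u\|}\right)u\right\rangle$; (b) for a.e. $t$: $H(X(t),P(t),u(t),p^0)=\max_{w\in\mathcal U}H(X(t),P(t),w,p^0)$; (c) $\max_{w\in\mathcal U}H(X(t_f),P(t_f),w,p^0)=-p^0\frac{\partial\ell}{\partial t}(t_f,X(t_f))$. Switching function: $\Psi(t)=\frac{T}{m(t)}\|p_v(t)\|-p_m(t)q$. *)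

theory Defs
  imports "HOL-Analysis.Analysis"
begin

(* The state (r, v, m) and the adjoint vector (p_r, p_v, p_m) share this type. *)
type_synonym state = "(real ^ 3) \<times> (real ^ 3) \<times> real"

abbreviation r_part :: "state \<Rightarrow> real ^ 3" where "r_part X \<equiv> fst X"
abbreviation v_part :: "state \<Rightarrow> real ^ 3" where "v_part X \<equiv> fst (snd X)"
abbreviation m_part :: "state \<Rightarrow> real" where "m_part X \<equiv> snd (snd X)"

(* The classical epsilon-delta notion. The library's absolutely_continuous is the relation between
   measures. The elements of a division are nonempty compact intervals K = [Inf K, Sup K] with
   pairwise disjoint interiors. *)
definition abs_continuous_on :: "real set \<Rightarrow> (real \<Rightarrow> 'a::real_normed_vector) \<Rightarrow> bool" where
  "abs_continuous_on S f \<longleftrightarrow>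
     (\<forall>\<epsilon>>0. \<exists>\<delta>>0. \<forall>D. D division_of \<Union>D \<and> \<Union>D \<subseteq> S \<and> (\<Sum>K\<in>D. Sup K - Inf K) < \<delta> \<longrightarrow>
        (\<Sum>K\<in>D. norm (f (Sup K) - f (Inf K))) < \<epsilon>)"

definition is_max_of :: "real \<Rightarrow> ('a \<Rightarrow> real) \<Rightarrow> 'a set \<Rightarrow> bool" where
  "is_max_of M f S \<longleftrightarrow> M \<in> f ` S \<and> (\<forall>x\<in>S. f x \<le> M)"

definition gravity :: "real \<Rightarrow> real ^ 3" where
  "gravity g0 = vector [0, 0, g0]"

(* For w = 0 the quotient is undefined on paper; here the thrust is then 0. The case cannot occur
   for admissible controls when T * umin >= \<sigma> > 0. *)
definition thrust :: "real \<Rightarrow> real \<Rightarrow> real ^ 3 \<Rightarrow> real ^ 3" where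
  "thrust T \<sigma> w = (T - \<sigma> / norm w) *\<^sub>R w"

definition control_set :: "real \<Rightarrow> real \<Rightarrow> (real ^ 3) set" where
  "control_set umin umax = {w. umin \<le> norm w \<and> norm w \<le> umax}"

definition dynamics :: "real \<Rightarrow> real \<Rightarrow> real \<Rightarrow> real \<Rightarrow> state \<Rightarrow> real ^ 3 \<Rightarrow> state" where
  "dynamics T \<sigma> q g0 X w =
     (v_part X, (1 / m_part X) *\<^sub>R thrust T \<sigma> w - gravity g0, - q * norm w)"

definition pa_admissible ::
  "real \<Rightarrow> real \<Rightarrow> real \<Rightarrow> real \<Rightarrow> real \<Rightarrow> real \<Rightarrow> real \<Rightarrow> real \<Rightarrow> real ^ 3 \<Rightarrow> real ^ 3 \<Rightarrow>
   real \<Rightarrow> (real \<Rightarrow> state) \<Rightarrow> (real \<Rightarrow> real ^ 3) \<Rightarrow> bool" where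
  "pa_admissible T \<sigma> q g0 m0 me umin umax r0 v0 tf X u \<longleftrightarrow>
     0 \<le> tf \<and>
     u \<in> borel_measurable (lebesgue_on {0..tf}) \<and>
     (AE t in lebesgue_on {0..tf}. u t \<in> control_set umin umax) \<and>
     abs_continuous_on {0..tf} X \<and>
     (AE t in lebesgue_on {0..tf}.
        (X has_vector_derivative dynamics T \<sigma> q g0 (X t) (u t)) (at t within {0..tf})) \<and>
     X 0 = (r0, v0, m0) \<and>
     r_part (X tf) $ 3 = 0 \<and> v_part (X tf) $ 3 = 0 \<and>
     (\<forall>t\<in>{0..<tf}. m_part (X t) > me)"

definition pa_optimal ::
  "real \<Rightarrow> real \<Rightarrow> real \<Rightarrow> real \<Rightarrow> real \<Rightarrow> real \<Rightarrow> real \<Rightarrow> real \<Rightarrow> real ^ 3 \<Rightarrow> real ^ 3 \<Rightarrow>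
   (real \<Rightarrow> state \<Rightarrow> real) \<Rightarrow> real \<Rightarrow> (real \<Rightarrow> state) \<Rightarrow> (real \<Rightarrow> real ^ 3) \<Rightarrow> bool" where
  "pa_optimal T \<sigma> q g0 m0 me umin umax r0 v0 cost tf X u \<longleftrightarrow>
     pa_admissible T \<sigma> q g0 m0 me umin umax r0 v0 tf X u \<and>
     (\<forall>tf' X' u'. pa_admissible T \<sigma> q g0 m0 me umin umax r0 v0 tf' X' u' \<longrightarrow>
        cost tf (X tf) \<le> cost tf' (X' tf'))"

(* There is no running cost, so the value does not depend on p0. *)
definition hamiltonian ::
  "real \<Rightarrow> real \<Rightarrow> real \<Rightarrow> real \<Rightarrow> state \<Rightarrow> state \<Rightarrow> real ^ 3 \<Rightarrow> real \<Rightarrow> real" where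
  "hamiltonian T \<sigma> q g0 X P w p0 =
     r_part P \<bullet> v_part X
     + v_part P \<bullet> ((1 / m_part X) *\<^sub>R thrust T \<sigma> w - gravity g0)
     - m_part P * q * norm w"

definition adjoint_field :: "real \<Rightarrow> real \<Rightarrow> state \<Rightarrow> state \<Rightarrow> real ^ 3 \<Rightarrow> state" where
  "adjoint_field T \<sigma> X P w =
     (0, - r_part P, 1 / (m_part X)\<^sup>2 * (v_part P \<bullet> thrust T \<sigma> w))"

definition pmp_multipliers ::
  "real \<Rightarrow> real \<Rightarrow> real \<Rightarrow> real \<Rightarrow> real \<Rightarrow> real \<Rightarrow> (real \<Rightarrow> state \<Rightarrow> real) \<Rightarrow>
   real \<Rightarrow> (real \<Rightarrow> state) \<Rightarrow> (real \<Rightarrow> real ^ 3) \<Rightarrow> (real \<Rightarrow> state) \<Rightarrow> real \<Rightarrow> bool" where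
  "pmp_multipliers T \<sigma> q g0 umin umax cost tf X u P p0 \<longleftrightarrow>
     p0 \<in> {0, -1} \<and>
     abs_continuous_on {0..tf} P \<and>
     \<not> (p0 = 0 \<and> (\<forall>t\<in>{0..tf}. P t = 0)) \<and>
     (AE t in lebesgue_on {0..tf}.
        (P has_vector_derivative adjoint_field T \<sigma> (X t) (P t) (u t)) (at t within {0..tf})) \<and>
     (AE t in lebesgue_on {0..tf}.
        is_max_of (hamiltonian T \<sigma> q g0 (X t) (P t) (u t) p0)
          (\<lambda>w. hamiltonian T \<sigma> q g0 (X t) (P t) w p0) (control_set umin umax)) \<and>
     (\<exists>d. ((\<lambda>t. cost t (X tf)) has_real_derivative d) (at tf) \<and>
        is_max_of (- p0 * d)
          (\<lambda>w. hamiltonian T \<sigma> q g0 (X tf) (P tf) w p0) (control_set umin umax))"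

definition switching_function ::
  "real \<Rightarrow> real \<Rightarrow> (real \<Rightarrow> state) \<Rightarrow> (real \<Rightarrow> state) \<Rightarrow> real \<Rightarrow> real" where
  "switching_function T q X P t =
     T / m_part (X t) * norm (v_part (P t)) - m_part (P t) * q"

end

(* The maximum condition aligns the control with p_v and makes the maximised Hamiltonian affine in
   |u| with slope Psi, so |u| = umax where Psi > 0 and |u| = umin where Psi < 0. Since p_v is affine
   in t, almost everywhere
     m^2 |p_v| Psi' = K,   K = T m <p_v, p_v'> + q sigma |p_v|^2.
   Once K >= 0 it stays so: |p_v| is convex, and T m + q sigma t is nonincreasing because
   T |u| >= T umin >= sigma. Hence Psi first decreases and then increases, and {Psi <= 0} is an
   interval [t1, t2]. If Psi takes a negative value, an interior zero of Psi in [t1, t2] would need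
   K = 0 there (otherwise Psi is strictly monotone towards one of the ends) and would then be a
   global minimum of Psi, a contradiction; so Psi < 0 almost everywhere on [t1, t2]. *)
theory Submission
  imports Defs
begin

section \<open>Absolutely continuous functions\<close>

lemma division_of_realD:
  fixes D :: "real set set"
  assumes "D division_of \<Union>D" "K \<in> D"
  shows "Inf K \<in> K" "Sup K \<in> K" "Inf K \<le> Sup K" "K = {Inf K..Sup K}"
proof -
  obtain a b where "K = cbox a b" using division_ofD(4)[OF assms] by blast
  moreover have "K \<noteq> {}" using division_ofD(3)[OF assms] .
  ultimately show "Inf K \<in> K" "Sup K \<in> K" "Inf K \<le> Sup K" "K = {Inf K..Sup K}" by auto
qed

text \<open>Increments of \<open>h\<close> over a division are dominated by those of
  \<open>f\<close> and \<open>g\<close>, and so are their sums. The closure properties below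
  (bounded linear images, sums, norms, products, reciprocals) all come from this estimate; unary
  operations take \<open>g = f\<close>.\<close>

lemma abs_continuous_on_lipschitz:
  assumes f: "abs_continuous_on S f" and g: "abs_continuous_on S g"
    and h: "\<And>x y. x \<in> S \<Longrightarrow> y \<in> S \<Longrightarrow> norm (h x - h y) \<le> L * (norm (f x - f y) + norm (g x - g y))"
  shows "abs_continuous_on S h"
  unfolding abs_continuous_on_def
proof (intro allI impI)
  fix e :: real assume e: "e > 0"
  \<comment> \<open>The sign of \<open>L\<close> is free; the strictly positive bound
    \<open>M\<close> can be divided by and keeps the last estimate strict.\<close>
  define M where "M = \<bar>L\<bar> + 1"
  have M: "M > 0" "L \<le> M" by (auto simp: M_def)
  define e' where "e' = e / (2 * M)"
  have e': "e' > 0" "M * (e' + e') = e" using e M by (auto simp: e'_def field_simps)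
  obtain d1 where d1: "d1 > 0" "\<And>D. D division_of \<Union>D \<Longrightarrow> \<Union>D \<subseteq> S \<Longrightarrow> (\<Sum>K\<in>D. Sup K - Inf K) < d1
      \<Longrightarrow> (\<Sum>K\<in>D. norm (f (Sup K) - f (Inf K))) < e'"
    using f e'(1) unfolding abs_continuous_on_def by meson
  obtain d2 where d2: "d2 > 0" "\<And>D. D division_of \<Union>D \<Longrightarrow> \<Union>D \<subseteq> S \<Longrightarrow> (\<Sum>K\<in>D. Sup K - Inf K) < d2
      \<Longrightarrow> (\<Sum>K\<in>D. norm (g (Sup K) - g (Inf K))) < e'"
    using g e'(1) unfolding abs_continuous_on_def by meson
  show "\<exists>\<delta>>0. \<forall>D. D division_of \<Union> D \<and> \<Union> D \<subseteq> S \<and> (\<Sum>K\<in>D. Sup K - Inf K) < \<delta> \<longrightarrow>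
             (\<Sum>K\<in>D. norm (h (Sup K) - h (Inf K))) < e"
  proof (intro exI[of _ "min d1 d2"] conjI allI impI)
    show "min d1 d2 > 0" using d1 d2 by simp
    fix D :: "real set set"
    assume D: "D division_of \<Union> D \<and> \<Union> D \<subseteq> S \<and> (\<Sum>K\<in>D. Sup K - Inf K) < min d1 d2"
    have "norm (h (Sup K) - h (Inf K)) \<le> M * (norm (f (Sup K) - f (Inf K)) + norm (g (Sup K) - g (Inf K)))"
      if "K \<in> D" for K
    proof -
      have "Inf K \<in> S" "Sup K \<in> S" using division_of_realD[of D K] that D by blast+
      from h[OF this(2,1)] show ?thesis
        using mult_right_mono[OF M(2), of "norm (f (Sup K) - f (Inf K)) + norm (g (Sup K) - g (Inf K))"]
        by fastforce
    qed
    then have "(\<Sum>K\<in>D. norm (h (Sup K) - h (Inf K)))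
      \<le> M * ((\<Sum>K\<in>D. norm (f (Sup K) - f (Inf K))) + (\<Sum>K\<in>D. norm (g (Sup K) - g (Inf K))))"
      unfolding sum.distrib[symmetric] sum_distrib_left by (rule sum_mono)
    also have "\<dots> < M * (e' + e')"
      using d1(2)[of D] d2(2)[of D] D M(1) by (intro mult_strict_left_mono add_strict_mono) auto
    finally show "(\<Sum>K\<in>D. norm (h (Sup K) - h (Inf K))) < e" using e' by simp
  qed
qed

lemma abs_continuous_on_ident: "abs_continuous_on S (\<lambda>t::real. t)"
  unfolding abs_continuous_on_def
proof (intro allI impI)
  fix e :: real assume "e > 0"
  moreover have "(\<Sum>K\<in>D. norm (Sup K - Inf K)) = (\<Sum>K\<in>D. Sup K - Inf K)" if "D division_of \<Union> D" for D :: "real set set"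
    using division_of_realD[OF that] by (intro sum.cong) auto
  ultimately show "\<exists>\<delta>>0. \<forall>D. D division_of \<Union> D \<and> \<Union> D \<subseteq> S \<and> (\<Sum>K\<in>D. Sup K - Inf K) < \<delta> \<longrightarrow>
             (\<Sum>K\<in>D. norm (Sup K - Inf K)) < e"
    by (intro exI[of _ e]) auto
qed

lemma abs_continuous_on_subset:
  "abs_continuous_on S f \<Longrightarrow> T \<subseteq> S \<Longrightarrow> abs_continuous_on T f"
  unfolding abs_continuous_on_def by (meson subset_trans)

lemma abs_continuous_on_imp_continuous_on:
  assumes f: "abs_continuous_on {a..b} f"
  shows "continuous_on {a..b} f"
  unfolding continuous_on_iff
proof (intro ballI allI impI)
  fix x e :: real assume x: "x \<in> {a..b}" and "e > 0"
  then obtain d where d: "d > 0" "\<And>D. D division_of \<Union>D \<Longrightarrow> \<Union>D \<subseteq> {a..b} \<Longrightarrow> (\<Sum>K\<in>D. Sup K - Inf K) < d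
      \<Longrightarrow> (\<Sum>K\<in>D. norm (f (Sup K) - f (Inf K))) < e"
    using f unfolding abs_continuous_on_def by meson
  \<comment> \<open>A division consisting of the single interval \<open>cbox u v\<close> turns the
    definition into a bound on one increment.\<close>
  have *: "norm (f v - f u) < e" if "u \<in> {a..b}" "v \<in> {a..b}" "u \<le> v" "v - u < d" for u v
    using d(2)[of "{cbox u v}"] division_of_self[of u v] that by auto
  have "dist (f y) (f x) < e" if "y \<in> {a..b}" "dist y x < d" for y
    using *[of x y] *[of y x] that x
    by (cases "x \<le> y") (auto simp: dist_norm norm_minus_commute)
  then show "\<exists>d>0. \<forall>x'\<in>{a..b}. dist x' x < d \<longrightarrow> dist (f x') (f x) < e"
    using d(1) by blast
qed

section \<open>Null sets, and monotonicity from the sign of the derivative almost everywhere\<close>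

lemma AE_lebesgue_on_negligible:
  assumes "AE t in lebesgue_on S. Q t" "S \<in> sets lebesgue"
  obtains N where "negligible N" "\<And>t. t \<in> S \<Longrightarrow> t \<notin> N \<Longrightarrow> Q t"
proof -
  have "AE t in lebesgue. t \<in> S \<longrightarrow> Q t" using assms by (simp add: AE_restrict_space_iff)
  then show ?thesis using that unfolding eventually_ae_filter_negligible by blast
qed

lemma AE_lebesgue_onI:
  assumes "negligible N" "\<And>t. t \<in> S \<Longrightarrow> t \<notin> N \<Longrightarrow> Q t" "S \<in> sets lebesgue"
  shows "AE t in lebesgue_on S. Q t"
  using assms by (auto simp: AE_restrict_space_iff eventually_ae_filter_negligible)

lemma abs_continuous_on_deriv_nonneg_imp_le:
  fixes f f' :: "real \<Rightarrow> real"
  assumes f: "abs_continuous_on {a..b} f" and ab: "a \<le> b" and N: "negligible N"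
    and der: "\<And>t. t \<in> {a..b} \<Longrightarrow> t \<notin> N \<Longrightarrow> (f has_vector_derivative f' t) (at t within {a..b})"
    and nonneg: "\<And>t. t \<in> {a..b} \<Longrightarrow> t \<notin> N \<Longrightarrow> f' t \<ge> 0"
  shows "f a \<le> f b"
proof (rule field_le_epsilon)
  \<comment> \<open>Cousin's lemma: intervals tagged off \<open>N\<close> are controlled by the derivative, those tagged in \<open>N\<close>
    lie in an open set of small measure, where absolute continuity applies.\<close>
  fix e0 :: real assume e0: "e0 > 0"
  \<comment> \<open>Intervals tagged in \<open>N\<close> will cost at most \<open>e\<close>, the
    others at most \<open>e * (b - a)\<close>, hence \<open>e0\<close> in all.\<close>
  define e where "e = e0 / (1 + (b - a))"
  have e: "e > 0" using e0 ab by (simp add: e_def)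
  have e_eq: "e + e * (b - a) = e0"
    using ab distrib_left[of e 1 "b - a"] by (simp add: e_def)
  obtain d where d: "d > 0" "\<And>D. D division_of \<Union>D \<Longrightarrow> \<Union>D \<subseteq> {a..b} \<Longrightarrow> (\<Sum>K\<in>D. Sup K - Inf K) < d
      \<Longrightarrow> (\<Sum>K\<in>D. norm (f (Sup K) - f (Inf K))) < e"
    using f e unfolding abs_continuous_on_def by meson
  \<comment> \<open>Outer regularity bounds the measure of \<open>U - N\<close>; since
    \<open>N\<close> is null, the same bound passes to \<open>U\<close>.\<close>
  obtain U where U: "open U" "N \<subseteq> U" "U - N \<in> lmeasurable" "emeasure lebesgue (U - N) < ennreal d"
    using sets_lebesgue_outer_open[of N d] N d(1) negligible_imp_sets by blast
  have Nl: "N \<in> lmeasurable" "measure lebesgue N = 0"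
    using N unfolding negligible_iff_measure by blast+
  have Ul: "U \<in> lmeasurable"
    using fmeasurable.Un[OF U(3) Nl(1)] U(2) by (simp add: Un_absorb2)
  have "measure lebesgue (U - N) < d"
    using U(3,4) d(1) by (simp add: emeasure_eq_measure2 ennreal_less_iff)
  moreover have "measure lebesgue U = measure lebesgue (U - N)"
    using measurable_measure_Diff[OF Ul fmeasurableD[OF Nl(1)] U(2)] Nl(2) by linarith
  ultimately have Ud: "measure lebesgue U < d" by simp
  have "\<exists>r>0. (t \<in> N \<longrightarrow> ball t r \<subseteq> U) \<and>
        (t \<notin> N \<longrightarrow> (\<forall>y\<in>{a..b}. \<bar>y - t\<bar> < r \<longrightarrow> \<bar>f y - f t - (y - t) * f' t\<bar> \<le> e * \<bar>y - t\<bar>))"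
    if t: "t \<in> {a..b}" for t
  proof (cases "t \<in> N")
    case True
    then show ?thesis using U(1,2) by (metis open_contains_ball subsetD)
  next
    case False
    from der[OF t this] show ?thesis
      using False e
      unfolding has_vector_derivative_def has_derivative_within_alt real_norm_def real_scaleR_def by blast
  qed
  then obtain r where r: "\<And>t. t \<in> {a..b} \<Longrightarrow> r t > 0"
    "\<And>t. t \<in> {a..b} \<Longrightarrow> t \<in> N \<Longrightarrow> ball t (r t) \<subseteq> U"
    "\<And>t y. t \<in> {a..b} \<Longrightarrow> t \<notin> N \<Longrightarrow> y \<in> {a..b} \<Longrightarrow> \<bar>y - t\<bar> < r t
         \<Longrightarrow> \<bar>f y - f t - (y - t) * f' t\<bar> \<le> e * \<bar>y - t\<bar>"
    by metis
  define \<gamma> where "\<gamma> t = ball t (if t \<in> {a..b} then r t else 1)" for t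
  have "gauge \<gamma>" using r(1) by (auto simp: gauge_def \<gamma>_def)
  then obtain p where p: "p tagged_division_of {a..b}" "\<gamma> fine p"
    using fine_division_exists_real by blast
  have fin: "finite p" using p(1) by blast
  have pK: "x \<in> {a..b} \<and> x \<in> K \<and> K \<subseteq> {a..b} \<and> K \<subseteq> ball x (r x) \<and> Inf K \<in> K \<and> Sup K \<in> K \<and> Inf K \<le> x \<and> x \<le> Sup K"
    if xK: "(x, K) \<in> p" for x K
  proof -
    have *: "x \<in> K" "K \<subseteq> {a..b}" using tagged_division_ofD(2,3)[OF p(1) xK] by auto
    moreover have "K \<subseteq> \<gamma> x" using p(2) xK by (auto simp: fine_def)
    moreover obtain u v where "K = cbox u v" using tagged_division_ofD(4)[OF p(1) xK] by blast
    ultimately show ?thesis by (auto simp: \<gamma>_def split: if_splits)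
  qed
  define p1 where "p1 = {xk \<in> p. fst xk \<in> N}"
  define p2 where "p2 = {xk \<in> p. fst xk \<notin> N}"
  have p12: "p = p1 \<union> p2" "p1 \<inter> p2 = {}" "finite p1" "finite p2" using fin by (auto simp: p1_def p2_def)
  have t1: "p1 tagged_division_of \<Union>(snd ` p1)"
    using p(1) tagged_partial_division_subset[of p _ p1] tagged_partial_division_of_Union_self
    unfolding tagged_division_of_def[of p] p1_def by blast
  have D1: "snd ` p1 division_of \<Union>(snd ` p1)" by (rule division_of_tagged_division[OF t1])
  \<comment> \<open>Passing from a sum over tagged pairs to one over intervals requires a summand
    that vanishes on every interval with empty interior. This includes the empty one, where
    \<open>Inf\<close> and \<open>Sup\<close> carry no information, so \<open>V\<close> is set to 0
    there.\<close>
  define V where "V K = (if K = {} then 0 else \<bar>f (Sup K) - f (Inf K)\<bar>)" for K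
  have V: "V K = \<bar>f (Sup K) - f (Inf K)\<bar>" if "(x, K) \<in> p1" for x K
    using pK[of x K] that by (auto simp: V_def p1_def)
  have "(\<Sum>(x, K)\<in>p1. \<bar>f (Sup K) - f (Inf K)\<bar>) = (\<Sum>(x, K)\<in>p1. V K)"
    using V by (intro sum.cong) auto
  also have "\<dots> = (\<Sum>K\<in>snd ` p1. V K)"
  proof (rule sum.over_tagged_division_lemma[OF t1])
    fix u v :: real assume "box u v = {}"
    then show "V (cbox u v) = 0" by (cases "u = v") (auto simp: V_def)
  qed
  also have "\<dots> = (\<Sum>K\<in>snd ` p1. \<bar>f (Sup K) - f (Inf K)\<bar>)"
    using V by (intro sum.cong) auto
  also have "\<dots> < e"
  proof -
    have "(\<Sum>K\<in>snd ` p1. Sup K - Inf K) = (\<Sum>K\<in>snd ` p1. measure lebesgue K)"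
    proof (rule sum.cong)
      fix K assume "K \<in> snd ` p1"
      from division_of_realD(3,4)[OF D1 this] show "Sup K - Inf K = measure lebesgue K"
        by (metis measure_lborel_Icc measure_completion borel_closed closed_atLeastAtMost sets_lborel)
    qed simp
    also have "\<dots> = measure lebesgue (\<Union>(snd ` p1))"
      using content_division[OF D1] by simp
    also have "\<dots> \<le> measure lebesgue U"
    proof (rule measure_mono_fmeasurable[OF _ _ Ul])
      have "K \<subseteq> U" if "(x, K) \<in> p1" for x K
        using pK[of x K] r(2)[of x] that unfolding p1_def by (metis (mono_tags, lifting) fst_conv mem_Collect_eq subset_trans)
      then show "\<Union>(snd ` p1) \<subseteq> U" by (metis UN_least prod.collapse)
      show "\<Union>(snd ` p1) \<in> sets lebesgue"
        using lmeasurable_division[OF D1] by blast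
    qed
    finally have "(\<Sum>K\<in>snd ` p1. Sup K - Inf K) < d" using Ud by linarith
    moreover have "\<Union>(snd ` p1) \<subseteq> {a..b}"
    proof -
      have "K \<subseteq> {a..b}" if "(x, K) \<in> p1" for x K
        using pK[of x K] that unfolding p1_def by blast
      then show ?thesis by (metis UN_least prod.collapse)
    qed
    ultimately show ?thesis using d(2)[OF D1] by simp
  qed
  finally have S1: "(\<Sum>(x, K)\<in>p1. \<bar>f (Sup K) - f (Inf K)\<bar>) < e" .
  have A1: "(\<Sum>(x, K)\<in>p1. f (Sup K) - f (Inf K)) \<ge> - (\<Sum>(x, K)\<in>p1. \<bar>f (Sup K) - f (Inf K)\<bar>)"
    unfolding sum_negf[symmetric] by (intro sum_mono) auto
  \<comment> \<open>Both ends of \<open>K\<close> are compared with the tag \<open>x\<close> between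
    them: the linear parts add up to \<open>(Sup K - Inf K) * f' x \<ge> 0\<close>, the errors to at
    most \<open>e\<close> times the length.\<close>
  have "f (Sup K) - f (Inf K) \<ge> - e * (Sup K - Inf K)" if "(x, K) \<in> p2" for x K
  proof -
    have x: "x \<in> {a..b}" "x \<notin> N" and K: "K \<subseteq> {a..b}" "Inf K \<le> x" "x \<le> Sup K" "Inf K \<in> K" "Sup K \<in> K" "K \<subseteq> ball x (r x)"
      using pK[of x K] that by (auto simp: p2_def)
    have "\<bar>f (Sup K) - f x - (Sup K - x) * f' x\<bar> \<le> e * \<bar>Sup K - x\<bar>"
      using x K by (intro r(3)) (auto simp: dist_real_def abs_minus_commute)
    moreover have "\<bar>f (Inf K) - f x - (Inf K - x) * f' x\<bar> \<le> e * \<bar>Inf K - x\<bar>"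
      using x K by (intro r(3)) (auto simp: dist_real_def abs_minus_commute)
    moreover have "(Sup K - x) * f' x \<ge> 0" "(Inf K - x) * f' x \<le> 0"
      using K nonneg[OF x] by (auto simp: mult_nonpos_nonneg)
    moreover have "\<bar>Sup K - x\<bar> = Sup K - x" "\<bar>Inf K - x\<bar> = x - Inf K" using K by auto
    ultimately show ?thesis by (simp add: algebra_simps)
  qed
  then have "(\<Sum>(x, K)\<in>p2. f (Sup K) - f (Inf K)) \<ge> (\<Sum>(x, K)\<in>p2. - e * (Sup K - Inf K))"
    by (intro sum_mono) auto
  moreover have "(\<Sum>(x, K)\<in>p2. - e * (Sup K - Inf K)) = - e * (\<Sum>(x, K)\<in>p2. Sup K - Inf K)"
    by (simp add: sum_distrib_left case_prod_unfold)
  moreover have "(\<Sum>(x, K)\<in>p2. Sup K - Inf K) \<le> (\<Sum>(x, K)\<in>p. Sup K - Inf K)"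
  proof (rule sum_mono2[OF fin])
    fix xK assume "xK \<in> p - p2"
    then show "0 \<le> (case xK of (x, K) \<Rightarrow> Sup K - Inf K)"
      using pK[of "fst xK" "snd xK"] by (cases xK) auto
  qed (use p12 in auto)
  moreover have "(\<Sum>(x, K)\<in>p. Sup K - Inf K) = b - a"
    using additive_tagged_division_1[OF ab p(1), of "\<lambda>t. t"] by simp
  moreover have "(\<Sum>(x, K)\<in>p. f (Sup K) - f (Inf K)) = f b - f a"
    using additive_tagged_division_1[OF ab p(1), of f] by simp
  moreover have "(\<Sum>(x, K)\<in>p. f (Sup K) - f (Inf K)) =
     (\<Sum>(x, K)\<in>p1. f (Sup K) - f (Inf K)) + (\<Sum>(x, K)\<in>p2. f (Sup K) - f (Inf K))"
    using p12 by (simp add: sum.union_disjoint)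
  moreover have "e * (\<Sum>(x, K)\<in>p2. Sup K - Inf K) \<le> e * (b - a)"
    using calculation e by (intro mult_left_mono) auto
  ultimately show "f a \<le> f b + e0" using S1 A1 e_eq by linarith
qed

lemma abs_continuous_on_deriv_nonneg_imp_mono:
  fixes f f' :: "real \<Rightarrow> real"
  assumes f: "abs_continuous_on {a..b} f" and N: "negligible N"
    and der: "\<And>t. t \<in> {a..b} \<Longrightarrow> t \<notin> N \<Longrightarrow> (f has_vector_derivative f' t) (at t within {a..b})"
    and st: "a \<le> s" "s \<le> t" "t \<le> b"
    and nonneg: "\<And>r. r \<in> {s..t} \<Longrightarrow> r \<notin> N \<Longrightarrow> f' r \<ge> 0"
  shows "f s \<le> f t"
proof (rule abs_continuous_on_deriv_nonneg_imp_le[OF _ st(2) N])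
  have sub: "{s..t} \<subseteq> {a..b}" using st by auto
  show "abs_continuous_on {s..t} f" by (rule abs_continuous_on_subset[OF f sub])
  show "(f has_vector_derivative f' r) (at r within {s..t})" if "r \<in> {s..t}" "r \<notin> N" for r
    using der[of r] that sub has_vector_derivative_within_subset by blast
qed (use nonneg in auto)

section \<open>Operations on absolutely continuous functions, constancy and strict
  monotonicity\<close>

lemma abs_continuous_on_bounded_linear:
  assumes "bounded_linear h" "abs_continuous_on S f"
  shows "abs_continuous_on S (\<lambda>x. h (f x))"
proof -
  obtain L where L: "L > 0" "\<And>x. norm (h x) \<le> norm x * L"
    using bounded_linear.pos_bounded[OF assms(1)] by blast
  show ?thesis
  proof (rule abs_continuous_on_lipschitz[OF assms(2,2), of _ L])
    fix x y
    have "norm (h (f x) - h (f y)) \<le> norm (f x - f y) * L"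
      using L(2)[of "f x - f y"] by (simp add: bounded_linear.linear[OF assms(1)] linear_diff)
    also have "\<dots> \<le> L * (norm (f x - f y) + norm (f x - f y))" using L(1) by (simp add: algebra_simps)
    finally show "norm (h (f x) - h (f y)) \<le> L * (norm (f x - f y) + norm (f x - f y))" .
  qed
qed

lemma abs_continuous_on_add:
  "abs_continuous_on S f \<Longrightarrow> abs_continuous_on S g \<Longrightarrow> abs_continuous_on S (\<lambda>x. f x + g x)"
  by (rule abs_continuous_on_lipschitz[of _ f g _ 1]) (auto simp: norm_diff_triangle_ineq)

lemma abs_continuous_on_norm:
  "abs_continuous_on S f \<Longrightarrow> abs_continuous_on S (\<lambda>x. norm (f x))"
  by (rule abs_continuous_on_lipschitz[of _ f f _ 1]) (auto intro: order_trans[OF norm_triangle_ineq3])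

text \<open>Continuity on a compact interval bounds both factors, and the usual splitting of the
  increment of a product does the rest.\<close>

lemma abs_continuous_on_mult:
  fixes f g :: "real \<Rightarrow> real"
  assumes f: "abs_continuous_on {a..b} f" and g: "abs_continuous_on {a..b} g"
  shows "abs_continuous_on {a..b} (\<lambda>t. f t * g t)"
proof -
  have "bounded (f ` {a..b})" "bounded (g ` {a..b})"
    using f g by (auto intro!: compact_imp_bounded compact_continuous_image abs_continuous_on_imp_continuous_on)
  then obtain B C where BC: "\<And>t. t \<in> {a..b} \<Longrightarrow> \<bar>f t\<bar> \<le> B" "\<And>t. t \<in> {a..b} \<Longrightarrow> \<bar>g t\<bar> \<le> C"
    unfolding bounded_iff ball_simps real_norm_def by blast
  show ?thesis
  proof (rule abs_continuous_on_lipschitz[OF f g, of _ "max B C"])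
    fix x y assume xy: "x \<in> {a..b}" "y \<in> {a..b}"
    have "f x * g x - f y * g y = f x * (g x - g y) + g y * (f x - f y)" by algebra
    then have "\<bar>f x * g x - f y * g y\<bar> \<le> \<bar>f x\<bar> * \<bar>g x - g y\<bar> + \<bar>g y\<bar> * \<bar>f x - f y\<bar>"
      by (metis abs_mult abs_triangle_ineq)
    also have "\<dots> \<le> max B C * \<bar>g x - g y\<bar> + max B C * \<bar>f x - f y\<bar>"
      using BC(1)[OF xy(1)] BC(2)[OF xy(2)] by (intro add_mono mult_right_mono) auto
    finally show "norm (f x * g x - f y * g y) \<le> max B C * (norm (f x - f y) + norm (g x - g y))"
      by (simp add: algebra_simps)
  qed
qed

lemma abs_continuous_on_inverse:
  fixes f :: "real \<Rightarrow> real"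
  assumes f: "abs_continuous_on S f" and c: "c > 0" "\<And>t. t \<in> S \<Longrightarrow> c \<le> f t"
  shows "abs_continuous_on S (\<lambda>t. inverse (f t))"
proof (rule abs_continuous_on_lipschitz[OF f f, of _ "inverse (c * c)"])
  fix x y assume "x \<in> S" "y \<in> S"
  then have xy: "c \<le> f x" "c \<le> f y" using c by auto
  then have p: "0 < f x" "0 < f y" "c * c \<le> f x * f y" using c(1) by (auto intro: mult_mono)
  have "\<bar>inverse (f x) - inverse (f y)\<bar> = \<bar>f x - f y\<bar> * inverse (f x * f y)"
    using p by (simp add: inverse_diff_inverse abs_mult field_simps)
  also have "\<dots> \<le> \<bar>f x - f y\<bar> * inverse (c * c)"
    using p c(1) by (intro mult_left_mono le_imp_inverse_le) auto
  also have "\<dots> \<le> inverse (c * c) * (\<bar>f x - f y\<bar> + \<bar>f x - f y\<bar>)"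
    using c(1) by (simp add: algebra_simps)
  finally show "norm (inverse (f x) - inverse (f y)) \<le> inverse (c * c) * (norm (f x - f y) + norm (f x - f y))"
    by simp
qed

text \<open>Taking the inner product with a fixed \<open>y\<close> reduces this to the scalar
  monotonicity result. One inequality is enough because \<open>y\<close> is arbitrary:
  \<open>y = f a - f t\<close> gives a nonpositive square.\<close>

lemma abs_continuous_on_zero_deriv_imp_eq:
  fixes f :: "real \<Rightarrow> 'a::real_inner"
  assumes f: "abs_continuous_on {a..b} f" and N: "negligible N"
    and der: "\<And>t. t \<in> {a..b} \<Longrightarrow> t \<notin> N \<Longrightarrow> (f has_vector_derivative 0) (at t within {a..b})"
    and t: "t \<in> {a..b}"
  shows "f t = f a"
proof -
  have "y \<bullet> f a \<le> y \<bullet> f t" for y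
  proof (rule abs_continuous_on_deriv_nonneg_imp_mono[where a = a and b = b
        and f = "\<lambda>s. y \<bullet> f s" and f' = "\<lambda>_. 0", OF _ N])
    show "abs_continuous_on {a..b} (\<lambda>s. y \<bullet> f s)"
      by (rule abs_continuous_on_bounded_linear[OF bounded_linear_inner_right f])
    show "((\<lambda>s. y \<bullet> f s) has_vector_derivative 0) (at s within {a..b})" if "s \<in> {a..b}" "s \<notin> N" for s
      using bounded_linear.has_vector_derivative[OF bounded_linear_inner_right der[OF that], of y] by simp
  qed (use t in auto)
  from this[of "f a - f t"] have "(f a - f t) \<bullet> (f a - f t) \<le> 0"
    by (simp add: inner_diff_right)
  then have "(f a - f t) \<bullet> (f a - f t) = 0" using inner_ge_zero[of "f a - f t"] by linarith
  then show ?thesis by simp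
qed

text \<open>If the end values agreed, the nondecreasing \<open>f\<close> would be constant on
  \<open>{s..t}\<close>. This interval is not null, so it has a point off \<open>N\<close>, where
  the derivative would be both 0 and positive.\<close>

lemma abs_continuous_on_deriv_pos_imp_less:
  fixes f f' :: "real \<Rightarrow> real"
  assumes f: "abs_continuous_on {a..b} f" and N: "negligible N"
    and der: "\<And>t. t \<in> {a..b} \<Longrightarrow> t \<notin> N \<Longrightarrow> (f has_vector_derivative f' t) (at t within {a..b})"
    and st: "a \<le> s" "s < t" "t \<le> b"
    and pos: "\<And>r. r \<in> {s..t} \<Longrightarrow> r \<notin> N \<Longrightarrow> f' r > 0"
  shows "f s < f t"
proof -
  have nonneg: "0 \<le> f' r" if "r \<in> {s..t}" "r \<notin> N" for r
    using pos[OF that] by simp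
  have mono: "f x \<le> f y" if "s \<le> x" "x \<le> y" "y \<le> t" for x y
    by (rule abs_continuous_on_deriv_nonneg_imp_mono[OF f N der])
      (use that st nonneg in auto)
  then have "f s \<le> f t" using st by simp
  moreover have False if eq: "f s = f t"
  proof -
    have const: "f r = f s" if "r \<in> {s..t}" for r
    proof -
      have "f s \<le> f r" "f r \<le> f t" using that st mono by auto
      then show ?thesis using eq by simp
    qed
    have "\<not> negligible {s..t}" using st(2) negligible_interval(1)[of s t] by simp
    then obtain r where r: "r \<in> {s..t}" "r \<notin> N" using N negligible_subset by blast
    have "(f has_vector_derivative f' r) (at r within {s..t})"
      using has_vector_derivative_within_subset[OF der[of r], of "{s..t}"] r st by auto
    moreover have "(f has_vector_derivative 0) (at r within {s..t})"
      by (rule has_vector_derivative_transform[OF r(1) const has_vector_derivative_const])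
    ultimately have "f' r = 0"
      using vector_derivative_unique_within_closed_interval[of s t r f] st(2) r(1) by auto
    then show False using pos[OF r] by simp
  qed
  ultimately show ?thesis using less_le by blast
qed

section \<open>The switching function\<close>

text \<open>The sign pattern of the switching function in abstract form, with \<open>K\<close>
  carrying the sign of the derivative. The restrictions in \<open>strict\<close> match what can be
  supplied later: a negative value of \<open>f\<close> will force \<open>q > 0\<close>, and
  \<open>t \<notin> N\<close> will keep \<open>p t\<close> away from zero.\<close>

lemma nonpositive_set_of_quasiconvex:
  fixes f f' K :: "real \<Rightarrow> real"
  assumes ab: "a \<le> b" and f: "abs_continuous_on {a..b} f" and N: "negligible N"
    and der: "\<And>t. t \<in> {a..b} \<Longrightarrow> t \<notin> N \<Longrightarrow> (f has_vector_derivative f' t) (at t within {a..b})"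
    and sgn: "\<And>t. t \<in> {a..b} \<Longrightarrow> t \<notin> N \<Longrightarrow> sgn (f' t) = sgn (K t)"
    and up: "\<And>s t. a \<le> s \<Longrightarrow> s \<le> t \<Longrightarrow> t \<le> b \<Longrightarrow> 0 \<le> K s \<Longrightarrow> 0 \<le> K t"
    and strict: "\<And>s t c. a \<le> s \<Longrightarrow> s \<le> t \<Longrightarrow> t \<le> b \<Longrightarrow> t \<notin> N \<Longrightarrow> c \<in> {a..b} \<Longrightarrow> f c < 0 \<Longrightarrow> 0 < K s \<Longrightarrow> 0 < K t"
  shows "\<exists>t1 t2 N'. a \<le> t1 \<and> t1 \<le> t2 \<and> t2 \<le> b \<and> negligible N' \<and>
    (\<forall>t\<in>{a..b} - {t1..t2} - N'. f t > 0) \<and>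
    ((\<forall>t\<in>{t1..t2} - N'. f t < 0) \<or> (\<forall>t\<in>{t1..t2}. f t = 0))"
proof -
  have g: "abs_continuous_on {a..b} (\<lambda>t. - f t)"
    by (rule abs_continuous_on_bounded_linear[OF bounded_linear_minus[OF bounded_linear_ident] f])
  have dg: "((\<lambda>t. - f t) has_vector_derivative - f' t) (at t within {a..b})" if "t \<in> {a..b}" "t \<notin> N" for t
    using der[OF that] by (rule has_vector_derivative_minus)
  have s1: "0 \<le> f' t \<longleftrightarrow> 0 \<le> K t" "0 < f' t \<longleftrightarrow> 0 < K t" "f' t \<le> 0 \<longleftrightarrow> K t \<le> 0" "f' t < 0 \<longleftrightarrow> K t < 0"
    if "t \<in> {a..b}" "t \<notin> N" for t
    using sgn[OF that] by (auto simp: sgn_if split: if_splits)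
  have incr: "f s \<le> f t" if "a \<le> s" "s \<le> t" "t \<le> b" "\<And>r. r \<in> {s..t} \<Longrightarrow> r \<notin> N \<Longrightarrow> 0 \<le> K r" for s t
    by (rule abs_continuous_on_deriv_nonneg_imp_mono[OF f N der that(1-3)]) (use that s1 in auto)
  have decr: "f t \<le> f s" if "a \<le> s" "s \<le> t" "t \<le> b" "\<And>r. r \<in> {s..t} \<Longrightarrow> r \<notin> N \<Longrightarrow> K r \<le> 0" for s t
    using abs_continuous_on_deriv_nonneg_imp_mono[OF g N dg that(1-3)] that s1 by auto
  have incr_less: "f s < f t" if "a \<le> s" "s < t" "t \<le> b" "\<And>r. r \<in> {s..t} \<Longrightarrow> r \<notin> N \<Longrightarrow> 0 < K r" for s t
    by (rule abs_continuous_on_deriv_pos_imp_less[OF f N der that(1-3)]) (use that s1 in auto)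
  have decr_less: "f t < f s" if "a \<le> s" "s < t" "t \<le> b" "\<And>r. r \<in> {s..t} \<Longrightarrow> r \<notin> N \<Longrightarrow> K r < 0" for s t
    using abs_continuous_on_deriv_pos_imp_less[OF g N dg that(1-3)] that s1 by auto
  define Z where "Z = {t \<in> {a..b}. f t \<le> 0}"
  show ?thesis
  proof (cases "Z = {}")
    case True
    then have "\<forall>t\<in>{a..b}. f t > 0" by (auto simp: Z_def)
    \<comment> \<open>A degenerate interval \<open>{a..a}\<close> is used; putting its point into
      \<open>N'\<close> makes the first alternative vacuous.\<close>
    then show ?thesis using ab by (intro exI[of _ a] exI[of _ "{a}"]) auto
  next
    case False
    have "closed Z"
      using continuous_closed_preimage[OF abs_continuous_on_imp_continuous_on[OF f], of "{..0}"]
      by (simp add: Z_def vimage_def Int_def)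
    moreover have bZ: "bdd_below Z" "bdd_above Z" by (auto simp: Z_def intro!: bdd_belowI bdd_aboveI)
    ultimately have Z: "Inf Z \<in> Z" "Sup Z \<in> Z"
      using False closed_contains_Inf[of Z] closed_contains_Sup[of Z] by auto
    define t1 t2 where "t1 = Inf Z" and "t2 = Sup Z"
    have t12: "a \<le> t1" "t1 \<le> t2" "t2 \<le> b" "f t1 \<le> 0" "f t2 \<le> 0"
      using Z bZ False by (auto simp: t1_def t2_def Z_def intro!: cInf_le_cSup)
    have out: "f t > 0" if "t \<in> {a..b} - {t1..t2}" for t
      using that cInf_lower[OF _ bZ(1), of t] cSup_upper[OF _ bZ(2), of t]
      unfolding t1_def t2_def by (force simp: Z_def)
    have right: "f t \<le> f w" if "a \<le> t" "t \<le> w" "w \<le> b" "0 \<le> K t" for t w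
      using that up[of t] by (intro incr) auto
    have neg: "K s < 0" if "a \<le> s" "s \<le> t" "t \<le> b" "K t < 0" for s t
      using that up[of s t] by force
    \<comment> \<open>This shows that \<open>Z\<close> has no gaps. If \<open>0 \<le> K t\<close>,
      then \<open>f\<close> is nondecreasing from \<open>t\<close> to \<open>t2\<close>; otherwise
      \<open>K\<close> is negative all the way back to \<open>t1\<close>. Either way
      \<open>f t\<close> is at most the value at an end.\<close>
    have le: "f t \<le> 0" if "t \<in> {t1..t2}" for t
    proof (cases "0 \<le> K t")
      case True
      then show ?thesis using right[of t t2] that t12 by auto
    next
      case False
      then have "f t \<le> f t1" using that t12 neg[of _ t] by (intro decr) (auto intro: less_imp_le)
      then show ?thesis using t12 by simp
    qed
    show ?thesis
    proof (cases "\<exists>c\<in>{a..b}. f c < 0")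
      case False
      have "f t = 0" if "t \<in> {t1..t2}" for t
      proof -
        have "t \<in> {a..b}" using that t12 by auto
        then have "\<not> f t < 0" using False by blast
        then show ?thesis using le[OF that] by simp
      qed
      then show ?thesis using t12 out by (intro exI[of _ t1] exI[of _ t2] exI[of _ "{}"]) auto
    next
      case True
      then obtain c where c: "c \<in> {a..b}" "f c < 0" by blast
      \<comment> \<open>The ends are left out because \<open>f\<close> may vanish there.\<close>
      have "f t < 0" if t: "t \<in> {t1..t2} - (N \<union> {t1, t2})" for t
      proof (rule ccontr)
        assume "\<not> f t < 0"
        then have ft: "f t = 0" using le[of t] t by auto
        have tt: "a \<le> t" "t1 < t" "t < t2" "t \<le> b" "t \<notin> N" using t t12 by auto
        consider "K t > 0" | "K t < 0" | "K t = 0" by linarith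
        then show False
        proof cases
          case 1
          then have "f t < f t2" using tt t12 c strict[of t] by (intro incr_less) auto
          then show False using ft t12 by simp
        next
          case 2
          then have "f t < f t1" using tt t12 neg[of _ t] by (intro decr_less) auto
          then show False using ft t12 by simp
        next
          case 3
          \<comment> \<open>With \<open>K t = 0\<close> the point \<open>t\<close> is a global
            minimum: to its right \<open>K \<ge> 0\<close> by \<open>up\<close>, and to its left
            \<open>K > 0\<close> is impossible since \<open>strict\<close> would carry it over to
            \<open>t\<close>.\<close>
          have "f t \<le> f c"
          proof (cases "t \<le> c")
            case True
            then show ?thesis using right[of t c] 3 c tt by auto
          next
            case False
            have "K r \<le> 0" if "r \<in> {c..t}" for r
              using strict[of r t c] that tt c 3 by (intro leI notI) auto
            then show ?thesis using False tt c by (intro decr) auto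
          qed
          then show False using ft c by simp
        qed
      qed
      then show ?thesis using t12 out N
        by (intro exI[of _ t1] exI[of _ t2] exI[of _ "N \<union> {t1, t2}"]) auto
    qed
  qed
qed

text \<open>Since \<open>T - \<sigma> / norm w \<ge> 0\<close>, Cauchy-Schwarz bounds the thrust
  term from above; comparison with the control of the same norm along the adjoint direction
  \<open>e\<close> bounds it from below. Comparison with \<open>r *\<^sub>R e\<close> then gives the
  second claim, because the terms with \<open>\<sigma>\<close> do not depend on the norm and
  cancel.\<close>

lemma hamiltonian_maximum:
  assumes pos: "T > 0" "\<sigma> > 0" "m_part X > 0" and low: "\<sigma> \<le> T * umin"
    and w: "w \<in> control_set umin umax"
    and max: "is_max_of (hamiltonian T \<sigma> q g0 X P w p0)
      (\<lambda>w. hamiltonian T \<sigma> q g0 X P w p0) (control_set umin umax)"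
  shows "v_part P \<bullet> thrust T \<sigma> w = (T * norm w - \<sigma>) * norm (v_part P)"
    and "\<And>r. umin \<le> r \<Longrightarrow> r \<le> umax \<Longrightarrow>
      r * (T / m_part X * norm (v_part P) - m_part P * q) \<le> norm w * (T / m_part X * norm (v_part P) - m_part P * q)"
proof -
  have umin: "umin > 0" using pos low by (metis less_le_trans zero_less_mult_pos)
  have nw: "norm w > 0" "umin \<le> norm w" "norm w \<le> umax" using w umin by (auto simp: control_set_def)
  \<comment> \<open>At a zero of the adjoint the direction of \<open>w\<close> serves as unit
    vector; it exists because \<open>umin > 0\<close>.\<close>
  define e where "e = (if v_part P = 0 then w /\<^sub>R norm w else v_part P /\<^sub>R norm (v_part P))"
  have e: "norm e = 1" "v_part P \<bullet> e = norm (v_part P)"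
    using nw by (auto simp: e_def dot_square_norm power2_eq_square)
  have thr: "v_part P \<bullet> thrust T \<sigma> (r *\<^sub>R e) = (T * r - \<sigma>) * norm (v_part P)" if "r > 0" for r
    using that e by (simp add: thrust_def algebra_simps)
  have ham: "v_part P \<bullet> thrust T \<sigma> (r *\<^sub>R e) / m_part X - m_part P * q * r
      \<le> v_part P \<bullet> thrust T \<sigma> w / m_part X - m_part P * q * norm w" if "umin \<le> r" "r \<le> umax" for r
  proof -
    have "r *\<^sub>R e \<in> control_set umin umax" "norm (r *\<^sub>R e) = r"
      using that umin e by (auto simp: control_set_def)
    then have "hamiltonian T \<sigma> q g0 X P (r *\<^sub>R e) p0 \<le> hamiltonian T \<sigma> q g0 X P w p0"
      using max by (auto simp: is_max_of_def)
    then show ?thesis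
      using \<open>norm (r *\<^sub>R e) = r\<close> by (simp add: hamiltonian_def inner_diff_right)
  qed
  have "v_part P \<bullet> thrust T \<sigma> (norm w *\<^sub>R e) \<le> v_part P \<bullet> thrust T \<sigma> w"
    using ham[of "norm w"] nw pos(3) by (simp add: divide_le_cancel)
  moreover have "v_part P \<bullet> thrust T \<sigma> w \<le> (T * norm w - \<sigma>) * norm (v_part P)"
  proof -
    have "\<sigma> \<le> T * norm w" using low nw(2) pos(1) by (meson mult_left_mono less_imp_le order_trans)
    then have "T - \<sigma> / norm w \<ge> 0" using nw(1) by (simp add: field_simps)
    moreover have "v_part P \<bullet> w \<le> norm (v_part P) * norm w" by (rule norm_cauchy_schwarz)
    ultimately have "(T - \<sigma> / norm w) * (v_part P \<bullet> w) \<le> (T - \<sigma> / norm w) * (norm (v_part P) * norm w)"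
      by (rule mult_left_mono[rotated])
    also have "\<dots> = (T * norm w - \<sigma>) * norm (v_part P)" using nw(1) by (simp add: field_simps)
    finally show ?thesis by (simp add: thrust_def)
  qed
  ultimately show thrust: "v_part P \<bullet> thrust T \<sigma> w = (T * norm w - \<sigma>) * norm (v_part P)"
    using thr[OF nw(1)] by simp
  fix r assume r: "umin \<le> r" "r \<le> umax"
  then have "(T * r - \<sigma>) * norm (v_part P) / m_part X - m_part P * q * r
     \<le> (T * norm w - \<sigma>) * norm (v_part P) / m_part X - m_part P * q * norm w"
    using ham[OF r] thr[of r] thrust umin by simp
  then show "r * (T / m_part X * norm (v_part P) - m_part P * q)
     \<le> norm w * (T / m_part X * norm (v_part P) - m_part P * q)"
    by (simp add: algebra_simps diff_divide_distrib)
qed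

section \<open>Propagation of the sign of the slope, and its formula\<close>

text \<open>For \<open>x = p\<^sub>v(s)\<close>, \<open>x + h b = p\<^sub>v(t)\<close>, \<open>M = T m(s)\<close>, \<open>M' = T m(t)\<close> and \<open>k = q \<sigma>\<close>, the two
  expressions are \<open>m\<^sup>2 \<lambda> \<Psi>'\<close> at \<open>s\<close> and \<open>t\<close>, where \<open>\<lambda> = \<parallel>p\<^sub>v\<parallel>\<close>. When \<open>\<lambda>' < 0\<close> their sign is that of
  \<open>k (\<lambda> / (-\<lambda>') + t) - (T m + k t)\<close>: the Newton iterate \<open>t + \<lambda> / (-\<lambda>')\<close> for a zero of the convex
  function \<open>\<lambda>\<close> increases with \<open>t\<close>, while \<open>T m + k t\<close> decreases.\<close>

lemma slope_sign:
  fixes x b :: "'a::real_inner"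
  assumes h: "0 \<le> h" and k: "0 \<le> k" and M: "0 < M'" "M' \<le> M - k * h"
  shows "0 \<le> M * (x \<bullet> b) + k * (norm x)\<^sup>2 \<Longrightarrow>
      0 \<le> M' * ((x + h *\<^sub>R b) \<bullet> b) + k * (norm (x + h *\<^sub>R b))\<^sup>2" (is "?A \<Longrightarrow> 0 \<le> ?B")
    and "0 < M * (x \<bullet> b) + k * (norm x)\<^sup>2 \<Longrightarrow> 0 < k \<Longrightarrow> x + h *\<^sub>R b \<noteq> 0 \<Longrightarrow>
      0 < M' * ((x + h *\<^sub>R b) \<bullet> b) + k * (norm (x + h *\<^sub>R b))\<^sup>2"
proof -
  \<comment> \<open>In the notation above, \<open>g\<close> and \<open>g'\<close> are the values of
    \<open>-\<lambda> \<lambda>'\<close> at the two times; they are positive exactly where the norm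
    is decreasing.\<close>
  define g g' X B L where "g = - (x \<bullet> b)" and "g' = - ((x + h *\<^sub>R b) \<bullet> b)"
    and "X = (norm x)\<^sup>2" and "B = (norm b)\<^sup>2" and "L = (norm (x + h *\<^sub>R b))\<^sup>2"
  have g': "g' = g - h * B" by (simp add: g_def g'_def B_def inner_add_left dot_square_norm)
  have L: "L = X - 2 * h * g + h\<^sup>2 * B"
    unfolding L_def X_def B_def g_def
    unfolding power2_norm_eq_inner
    by (simp add: inner_add_left inner_add_right inner_commute[of b x] power2_eq_square algebra_simps)
  have B: "0 \<le> B" "0 \<le> L" by (auto simp: B_def L_def)
  have CS: "g\<^sup>2 \<le> X * B"
    using Cauchy_Schwarz_ineq[of x b] by (simp add: g_def X_def B_def power2_norm_eq_inner)
  \<comment> \<open>The comparison of Newton iterates, cross-multiplied by \<open>g\<close> and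
    \<open>g'\<close>. The difference of the two sides is \<open>(M - k * h - M') * g * g'\<close>
    plus \<open>k * h * (X * B - g\<^sup>2)\<close>, and the latter is nonnegative by
    Cauchy-Schwarz.\<close>
  have key: "g * (k * L - M' * g') \<ge> (k * X - M * g) * g'" if g'0: "g' > 0"
  proof -
    have g: "g > 0" using g' g'0 h B(1) by (smt (verit) mult_nonneg_nonneg)
    have "M' * (g * g') \<le> (M - k * h) * (g * g')"
      using M(2) g g'0 by (intro mult_right_mono) auto
    moreover have "k * (g * L - (X - h * g) * g') = k * h * (X * B - g\<^sup>2)"
      unfolding L g' by (simp add: algebra_simps power2_eq_square)
    moreover have "0 \<le> k * h * (X * B - g\<^sup>2)" using k h CS by simp
    ultimately show ?thesis by (simp add: algebra_simps)
  qed
  have gpos: "g > 0" if "g' > 0" using g' that h B(1) by (smt (verit) mult_nonneg_nonneg)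
  have eqs: "M * (x \<bullet> b) + k * (norm x)\<^sup>2 = k * X - M * g"
    "M' * ((x + h *\<^sub>R b) \<bullet> b) + k * (norm (x + h *\<^sub>R b))\<^sup>2 = k * L - M' * g'"
    by (auto simp: g_def g'_def X_def L_def)
  show "0 \<le> M' * ((x + h *\<^sub>R b) \<bullet> b) + k * (norm (x + h *\<^sub>R b))\<^sup>2"
    if "0 \<le> M * (x \<bullet> b) + k * (norm x)\<^sup>2"
  proof (cases "g' > 0")
    case True
    then have "0 \<le> g * (k * L - M' * g')"
      using key that unfolding eqs by (smt (verit) mult_nonneg_nonneg)
    then show ?thesis unfolding eqs using gpos[OF True] by (simp add: zero_le_mult_iff)
  next
    case False
    \<comment> \<open>The norm is not decreasing at the later time, so neither term of the
      expression is negative.\<close>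
    then have "M' * g' \<le> 0" using M(1) by (simp add: mult_nonneg_nonpos)
    moreover have "0 \<le> k * L" using k B by simp
    ultimately show ?thesis unfolding eqs by linarith
  qed
  show "0 < M' * ((x + h *\<^sub>R b) \<bullet> b) + k * (norm (x + h *\<^sub>R b))\<^sup>2"
    if "0 < M * (x \<bullet> b) + k * (norm x)\<^sup>2" "0 < k" "x + h *\<^sub>R b \<noteq> 0"
  proof (cases "g' > 0")
    case True
    then have "0 < (k * X - M * g) * g'" using that(1) unfolding eqs by simp
    then have "0 < g * (k * L - M' * g')" using key[OF True] by linarith
    then show ?thesis unfolding eqs using gpos[OF True] by (simp add: zero_less_mult_iff)
  next
    case False
    then have "M' * g' \<le> 0" using M(1) by (simp add: mult_nonneg_nonpos)
    moreover have "0 < k * L" using that(2,3) by (simp add: L_def)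
    ultimately show ?thesis unfolding eqs by linarith
  qed
qed

text \<open>The contributions of \<open>norm w\<close> from the mass equation and from the adjoint
  equation cancel, so the control drops out. The derivative \<open>l'\<close> of the norm stays
  abstract to cover both a nonzero adjoint and one that vanishes identically.\<close>

lemma switching_function_derivative:
  fixes X P :: "real \<Rightarrow> state"
  assumes X: "(X has_vector_derivative dynamics T \<sigma> q g0 (X t) w) (at t within S)"
    and P: "(P has_vector_derivative adjoint_field T \<sigma> (X t) (P t) w) (at t within S)"
    and m: "m_part (X t) > 0"
    and thr: "v_part (P t) \<bullet> thrust T \<sigma> w = (T * norm w - \<sigma>) * norm (v_part (P t))"
    and l: "((\<lambda>s. norm (v_part (P s))) has_vector_derivative l') (at t within S)"
  shows "(switching_function T q X P has_vector_derivative
     (T * m_part (X t) * l' + q * \<sigma> * norm (v_part (P t))) / (m_part (X t))\<^sup>2) (at t within S)"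
proof -
  have dm: "((\<lambda>s. m_part (X s)) has_real_derivative - q * norm w) (at t within S)"
    using bounded_linear.has_vector_derivative[OF bounded_linear_compose[OF bounded_linear_snd bounded_linear_snd] X]
    by (simp add: has_real_derivative_iff_has_vector_derivative dynamics_def)
  have dp: "((\<lambda>s. m_part (P s)) has_real_derivative
      1 / (m_part (X t))\<^sup>2 * ((T * norm w - \<sigma>) * norm (v_part (P t)))) (at t within S)"
    using bounded_linear.has_vector_derivative[OF bounded_linear_compose[OF bounded_linear_snd bounded_linear_snd] P]
    by (simp add: has_real_derivative_iff_has_vector_derivative adjoint_field_def thr)
  have dl: "((\<lambda>s. norm (v_part (P s))) has_real_derivative l') (at t within S)"
    using l by (simp add: has_real_derivative_iff_has_vector_derivative)
  have m0: "m_part (X t) \<noteq> 0" using m by simp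
  have eq: "switching_function T q X P =
     (\<lambda>s. T / m_part (X s) * norm (v_part (P s)) - m_part (P s) * q)"
    by (simp add: fun_eq_iff switching_function_def)
  show ?thesis
    unfolding eq has_real_derivative_iff_has_vector_derivative[symmetric]
    by (rule derivative_eq_intros dm dp dl m0 refl)+ (use m0 in \<open>simp add: field_simps power2_eq_square\<close>)
qed

lemma abs_continuous_on_switching_function:
  assumes X: "abs_continuous_on {a..b} X" and P: "abs_continuous_on {a..b} P"
    and m: "c > 0" "\<And>t. t \<in> {a..b} \<Longrightarrow> c \<le> m_part (X t)"
  shows "abs_continuous_on {a..b} (switching_function T q X P)"
proof -
  note ssnd = bounded_linear_compose[OF bounded_linear_snd bounded_linear_snd]
  note fsnd = bounded_linear_compose[OF bounded_linear_fst bounded_linear_snd]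
  have "abs_continuous_on {a..b} (\<lambda>t. T * (inverse (m_part (X t)) * norm (v_part (P t))) + - q * m_part (P t))"
    by (intro abs_continuous_on_add abs_continuous_on_bounded_linear[OF bounded_linear_mult_right]
      abs_continuous_on_mult abs_continuous_on_inverse[OF _ m] abs_continuous_on_norm
      abs_continuous_on_bounded_linear[OF ssnd X] abs_continuous_on_bounded_linear[OF ssnd P]
      abs_continuous_on_bounded_linear[OF fsnd P])
  moreover have "switching_function T q X P =
      (\<lambda>t. T * (inverse (m_part (X t)) * norm (v_part (P t))) + - q * m_part (P t))"
    by (auto simp: switching_function_def fun_eq_iff field_simps)
  ultimately show ?thesis by simp
qed

section \<open>The structure of the optimal control\<close>

theorem theorem3p9:
  fixes T \<sigma> q g0 m0 me umin umax tf p0 :: real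
    and r0 v0 :: "real ^ 3"
    and cost :: "real \<Rightarrow> state \<Rightarrow> real"
    and X P :: "real \<Rightarrow> state"
    and u :: "real \<Rightarrow> real ^ 3"
    and \<Psi> :: "real \<Rightarrow> real"
  assumes "T > 0" and "\<sigma> > 0" and "q \<ge> 0" and "g0 > 0"
    and "m0 > me" and "me > 0"
    and "0 \<le> umin" and "umin \<le> umax" and "umax \<le> 1"
    and "pa_optimal T \<sigma> q g0 m0 me umin umax r0 v0 cost tf X u"
    and "pmp_multipliers T \<sigma> q g0 umin umax cost tf X u P p0"
    and "T * umin \<ge> \<sigma>"
    and "\<Psi> = switching_function T q X P"
  shows "\<exists>t1 t2. 0 \<le> t1 \<and> t1 \<le> t2 \<and> t2 \<le> tf \<and>
           (AE t in lebesgue_on ({0..<t1} \<union> {t2<..tf}). norm (u t) = umax) \<and>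
           ((AE t in lebesgue_on {t1..t2}. norm (u t) = umin) \<or>
            (\<forall>t\<in>{t1..t2}. \<Psi> t = 0))"
proof -
  note ssnd = bounded_linear_compose[OF bounded_linear_snd bounded_linear_snd]
  note fsnd = bounded_linear_compose[OF bounded_linear_fst bounded_linear_snd]
  have adm: "pa_admissible T \<sigma> q g0 m0 me umin umax r0 v0 tf X u"
    using assms(10) by (simp add: pa_optimal_def)
  then have tf: "0 \<le> tf" and acX: "abs_continuous_on {0..tf} X" and X0: "X 0 = (r0, v0, m0)"
    and m_gt: "\<forall>t\<in>{0..<tf}. m_part (X t) > me"
    by (auto simp: pa_admissible_def)
  have acP: "abs_continuous_on {0..tf} P" using assms(11) by (simp add: pmp_multipliers_def)
  \<comment> \<open>All almost everywhere conditions are gathered first, so that a single null set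
    \<open>N\<close> serves for the whole proof.\<close>
  have "AE t in lebesgue_on {0..tf}. u t \<in> control_set umin umax \<and>
      (X has_vector_derivative dynamics T \<sigma> q g0 (X t) (u t)) (at t within {0..tf}) \<and>
      (P has_vector_derivative adjoint_field T \<sigma> (X t) (P t) (u t)) (at t within {0..tf}) \<and>
      is_max_of (hamiltonian T \<sigma> q g0 (X t) (P t) (u t) p0)
          (\<lambda>w. hamiltonian T \<sigma> q g0 (X t) (P t) w p0) (control_set umin umax)"
    using adm assms(11) by (simp add: pa_admissible_def pmp_multipliers_def)
  then obtain N where N: "negligible N"
    and uN: "\<And>t. t \<in> {0..tf} \<Longrightarrow> t \<notin> N \<Longrightarrow> u t \<in> control_set umin umax"
    and XN: "\<And>t. t \<in> {0..tf} \<Longrightarrow> t \<notin> N \<Longrightarrow>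
      (X has_vector_derivative dynamics T \<sigma> q g0 (X t) (u t)) (at t within {0..tf})"
    and PN: "\<And>t. t \<in> {0..tf} \<Longrightarrow> t \<notin> N \<Longrightarrow>
      (P has_vector_derivative adjoint_field T \<sigma> (X t) (P t) (u t)) (at t within {0..tf})"
    and maxN: "\<And>t. t \<in> {0..tf} \<Longrightarrow> t \<notin> N \<Longrightarrow> is_max_of (hamiltonian T \<sigma> q g0 (X t) (P t) (u t) p0)
          (\<lambda>w. hamiltonian T \<sigma> q g0 (X t) (P t) w p0) (control_set umin umax)"
    by (rule AE_lebesgue_on_negligible) auto
  define m where "m t = m_part (X t)" for t
  define p where "p t = v_part (P t)" for t
  have acm: "abs_continuous_on {0..tf} m"
    unfolding m_def by (rule abs_continuous_on_bounded_linear[OF ssnd acX])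
  \<comment> \<open>Admissibility bounds the mass on \<open>[0, tf)\<close> only; continuity extends
    the weak bound to \<open>tf\<close>. For \<open>tf = 0\<close> that interval is empty and the
    initial mass is used.\<close>
  have m_ge: "me \<le> m t" if t: "t \<in> {0..tf}" for t
  proof (cases "tf = 0")
    case True
    then show ?thesis using t X0 assms(5) by (simp add: m_def)
  next
    case False
    show ?thesis
    proof (rule continuous_ge_on_closure[of "{0..<tf}" m])
      show "continuous_on (closure {0..<tf}) m" "t \<in> closure {0..<tf}"
        using False tf t abs_continuous_on_imp_continuous_on[OF acm] by auto
    qed (use m_gt in \<open>auto simp: m_def less_imp_le\<close>)
  qed
  have m_pos: "0 < m t" if "t \<in> {0..tf}" for t using m_ge[OF that] assms(6) by linarith
  \<comment> \<open>This supplies the hypothesis \<open>M' \<le> M - k * h\<close> of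
    \<open>slope_sign\<close> with \<open>h = t - s\<close> and
    \<open>k = q * \<sigma>\<close>.\<close>
  have mass: "T * m t \<le> T * m s - q * \<sigma> * (t - s)" if "0 \<le> s" "s \<le> t" "t \<le> tf" for s t
  proof -
    let ?f = "\<lambda>t. - T * m t + - (q * \<sigma>) * t"
    have "?f s \<le> ?f t"
    proof (rule abs_continuous_on_deriv_nonneg_imp_mono[OF _ N _ that])
      show "abs_continuous_on {0..tf} ?f"
        by (intro abs_continuous_on_add abs_continuous_on_bounded_linear[OF bounded_linear_mult_right]
          acm abs_continuous_on_ident)
      fix r assume r: "r \<in> {0..tf}" "r \<notin> N"
      have "(m has_vector_derivative - q * norm (u r)) (at r within {0..tf})"
        using bounded_linear.has_vector_derivative[OF ssnd XN[OF r]] by (simp add: m_def[abs_def] dynamics_def)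
      then show "(?f has_vector_derivative q * (T * norm (u r) - \<sigma>)) (at r within {0..tf})"
        unfolding has_real_derivative_iff_has_vector_derivative[symmetric]
        by (auto intro!: derivative_eq_intros simp: algebra_simps)
    next
      fix r assume "r \<in> {s..t}" "r \<notin> N"
      then have "umin \<le> norm (u r)" using uN[of r] that by (auto simp: control_set_def)
      then have "\<sigma> \<le> T * norm (u r)" using assms(1,12) by (meson mult_left_mono less_imp_le order_trans)
      then show "0 \<le> q * (T * norm (u r) - \<sigma>)" using assms(3) by simp
    qed
    then show ?thesis by (simp add: algebra_simps)
  qed
  have pr: "r_part (P t) = r_part (P 0)" if "t \<in> {0..tf}" for t
  proof (rule abs_continuous_on_zero_deriv_imp_eq[OF _ N _ that])
    show "abs_continuous_on {0..tf} (\<lambda>t. r_part (P t))"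
      by (rule abs_continuous_on_bounded_linear[OF bounded_linear_fst acP])
    show "((\<lambda>t. r_part (P t)) has_vector_derivative 0) (at r within {0..tf})"
      if "r \<in> {0..tf}" "r \<notin> N" for r
      using bounded_linear.has_vector_derivative[OF bounded_linear_fst PN[OF that]]
      by (simp add: adjoint_field_def)
  qed
  \<comment> \<open>Constancy of \<open>p_r\<close> makes \<open>b\<close> the derivative of
    \<open>p\<close> almost everywhere; absolute continuity then makes \<open>p\<close> affine on
    the whole interval.\<close>
  define b where "b = - r_part (P 0)"
  have dp: "(p has_vector_derivative b) (at t within {0..tf})" if "t \<in> {0..tf}" "t \<notin> N" for t
    using bounded_linear.has_vector_derivative[OF fsnd PN[OF that]] pr[OF that(1)]
    by (simp add: adjoint_field_def p_def[abs_def] b_def)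
  have pt: "p t = p 0 + t *\<^sub>R b" if "t \<in> {0..tf}" for t
  proof -
    have "p t + t *\<^sub>R (- b) = p 0 + 0 *\<^sub>R (- b)"
    proof (rule abs_continuous_on_zero_deriv_imp_eq[OF _ N _ that])
      show "abs_continuous_on {0..tf} (\<lambda>t. p t + t *\<^sub>R (- b))"
        unfolding p_def
        by (intro abs_continuous_on_add abs_continuous_on_bounded_linear[OF fsnd acP]
          abs_continuous_on_bounded_linear[OF bounded_linear_scaleR_left abs_continuous_on_ident])
      show "((\<lambda>t. p t + t *\<^sub>R - b) has_vector_derivative 0) (at r within {0..tf})"
        if "r \<in> {0..tf}" "r \<notin> N" for r
        using has_vector_derivative_add[OF dp[OF that]
            bounded_linear.has_vector_derivative[OF bounded_linear_scaleR_left[of "- b"] has_vector_derivative_id]]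
        by simp
    qed
    then show ?thesis by (simp add: algebra_simps)
  qed
  have pst: "p t = p s + (t - s) *\<^sub>R b" if "s \<in> {0..tf}" "t \<in> {0..tf}" for s t
    using pt[OF that(1)] pt[OF that(2)] by (simp add: algebra_simps)
  \<comment> \<open>Multiplying the slope by \<open>(m t)\<^sup>2 * norm (p t)\<close> removes the
    quotients, so \<open>K\<close> makes sense at zeros of \<open>p\<close> as well.\<close>
  define K where "K t = T * m t * (p t \<bullet> b) + q * \<sigma> * (norm (p t))\<^sup>2" for t
  have K_up: "0 \<le> K t" if "0 \<le> s" "s \<le> t" "t \<le> tf" "0 \<le> K s" for s t
    using slope_sign(1)[of "t - s" "q * \<sigma>" "T * m t" "T * m s" "p s" b] mass[OF that(1-3)] that
      m_pos[of t] assms(1-3) pst[of s t] by (simp add: K_def)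
  have K_strict: "0 < K t" if "0 \<le> s" "s \<le> t" "t \<le> tf" "0 < K s" "0 < q" "p t \<noteq> 0" for s t
    using slope_sign(2)[of "t - s" "q * \<sigma>" "T * m t" "T * m s" "p s" b] mass[OF that(1-3)] that
      m_pos[of t] assms(1-3) pst[of s t] by (simp add: K_def)
  \<comment> \<open>The affine function \<open>p\<close> vanishes identically or at most at \<open>z\<close>
    (the junk value \<open>0\<close> if \<open>b = 0\<close>).\<close>
  define z where "z = - (p 0 \<bullet> b) / (b \<bullet> b)"
  define N1 where "N1 = insert z N"
  have N1: "negligible N1" using N by (simp add: N1_def)
  have p_zero: "\<forall>s\<in>{0..tf}. p s = 0" if "t \<in> {0..tf}" "t \<notin> N1" "p t = 0" for t
  proof (cases "b = 0")
    case True
    then show ?thesis using pt[OF that(1)] that(3) pt by (metis add.right_neutral scaleR_zero_right)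
  next
    case False
    have "(p 0 + t *\<^sub>R b) \<bullet> b = 0" using pt[OF that(1)] that(3) by simp
    then have "p 0 \<bullet> b + t * (b \<bullet> b) = 0" by (simp add: inner_add_left)
    then have "t = z" using False by (simp add: z_def field_simps)
    then show ?thesis using that(2) by (simp add: N1_def)
  qed
  \<comment> \<open>Where \<open>p t = 0\<close>, division by zero gives \<open>D t = 0\<close>. Off
    \<open>N1\<close> this is the true derivative, since \<open>p\<close> then vanishes
    identically.\<close>
  define D where "D t = K t / ((m t)\<^sup>2 * norm (p t))" for t
  have thr: "v_part (P t) \<bullet> thrust T \<sigma> (u t) = (T * norm (u t) - \<sigma>) * norm (v_part (P t))"
    and swi: "umin \<le> r \<Longrightarrow> r \<le> umax \<Longrightarrow> r * \<Psi> t \<le> norm (u t) * \<Psi> t"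
    if "t \<in> {0..tf}" "t \<notin> N" for t r
    using hamiltonian_maximum[OF assms(1,2) _ assms(12) uN[OF that] maxN[OF that]] m_pos[OF that(1)]
    unfolding assms(13) switching_function_def m_def by blast+
  have d\<Psi>: "(\<Psi> has_vector_derivative D t) (at t within {0..tf})" if t: "t \<in> {0..tf}" "t \<notin> N1" for t
  proof -
    have tN: "t \<notin> N" using t by (simp add: N1_def)
    note sw = switching_function_derivative[OF XN[OF t(1) tN] PN[OF t(1) tN] _ thr[OF t(1) tN]]
    show ?thesis
    proof (cases "p t = 0")
      case True
      then have all: "\<forall>s\<in>{0..tf}. p s = 0" using p_zero t by blast
      have "((\<lambda>s. norm (v_part (P s))) has_vector_derivative 0) (at t within {0..tf})"
        by (rule has_vector_derivative_transform[of t _ _ "\<lambda>_. 0"]) (use all t in \<open>auto simp: p_def\<close>)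
      from sw[OF _ this] show ?thesis
        using m_pos[OF t(1)] True by (simp add: assms(13) m_def p_def D_def)
    next
      case False
      have "((\<lambda>s. norm (v_part (P s))) has_vector_derivative (p t \<bullet> b) / norm (p t)) (at t within {0..tf})"
      proof -
        have "((\<lambda>s. norm (p s)) has_derivative (\<lambda>h. (h *\<^sub>R b) \<bullet> sgn (p t))) (at t within {0..tf})"
          using has_derivative_compose[OF dp[OF t(1) tN, unfolded has_vector_derivative_def] has_derivative_norm[OF False]]
          by (simp add: inner_commute)
        then show ?thesis
          unfolding has_vector_derivative_def p_def[symmetric]
          by (rule has_derivative_eq_rhs) (auto simp: sgn_div_norm inner_commute field_simps)
      qed
      from sw[OF _ this] have "(\<Psi> has_vector_derivative
          (T * m t * (p t \<bullet> b / norm (p t)) + q * \<sigma> * norm (p t)) / (m t)\<^sup>2) (at t within {0..tf})"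
        using m_pos[OF t(1)] by (simp add: assms(13) m_def p_def)
      moreover have "(T * m t * (p t \<bullet> b / norm (p t)) + q * \<sigma> * norm (p t)) / (m t)\<^sup>2 = D t"
        using False m_pos[OF t(1)] by (simp add: D_def K_def field_simps power2_eq_square)
      ultimately show ?thesis by simp
    qed
  qed
  have "\<exists>t1 t2 N'. 0 \<le> t1 \<and> t1 \<le> t2 \<and> t2 \<le> tf \<and> negligible N' \<and>
    (\<forall>t\<in>{0..tf} - {t1..t2} - N'. \<Psi> t > 0) \<and>
    ((\<forall>t\<in>{t1..t2} - N'. \<Psi> t < 0) \<or> (\<forall>t\<in>{t1..t2}. \<Psi> t = 0))"
  proof (rule nonpositive_set_of_quasiconvex[OF tf _ N1 d\<Psi>, of K])
    show "abs_continuous_on {0..tf} \<Psi>"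
      unfolding assms(13) using m_ge
      by (intro abs_continuous_on_switching_function[OF acX acP assms(6)]) (simp add: m_def)
    show "sgn (D t) = sgn (K t)" if "t \<in> {0..tf}" for t
    proof (cases "p t = 0")
      case False
      then show ?thesis using m_pos[OF that] by (simp add: D_def sgn_divide sgn_mult)
    qed (simp add: D_def K_def)
    \<comment> \<open>If \<open>q = 0\<close>, then \<open>\<Psi>\<close> is a nonnegative multiple
      of the norm of \<open>p\<close> and cannot be negative at \<open>c\<close>. A zero of
      \<open>p\<close> off \<open>N1\<close> would make \<open>p\<close> vanish throughout, against
      \<open>0 < K s\<close>.\<close>
    show "0 < K t" if "0 \<le> s" "s \<le> t" "t \<le> tf" "t \<notin> N1" "c \<in> {0..tf}" "\<Psi> c < 0" "0 < K s" for s t c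
    proof -
      have "q \<noteq> 0"
      proof
        assume "q = 0"
        then have "0 \<le> \<Psi> c" using assms(1) m_pos[OF that(5)] by (simp add: assms(13) switching_function_def m_def)
        then show False using that by simp
      qed
      moreover have "p t \<noteq> 0" using p_zero[of t] that by (auto simp: K_def)
      ultimately show ?thesis using K_strict that assms(3) by simp
    qed
  qed (use K_up in auto)
  then obtain t1 t2 N' where t12: "0 \<le> t1" "t1 \<le> t2" "t2 \<le> tf" and N': "negligible N'"
    and out: "\<forall>t\<in>{0..tf} - {t1..t2} - N'. \<Psi> t > 0"
    and ins: "(\<forall>t\<in>{t1..t2} - N'. \<Psi> t < 0) \<or> (\<forall>t\<in>{t1..t2}. \<Psi> t = 0)"
    by blast
  have NN: "negligible (N \<union> N')" using N N' by simp
  \<comment> \<open>Cancelling the positive factor \<open>\<Psi> t\<close> in the comparison with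
    \<open>r = umax\<close> leaves \<open>umax \<le> norm (u t)\<close>; below, a negative factor
    reverses the inequality for \<open>r = umin\<close>.\<close>
  have umax: "norm (u t) = umax" if "t \<in> {0..tf}" "t \<notin> N" "\<Psi> t > 0" for t
    using swi[OF that(1,2), of umax] uN[OF that(1,2)] that(3) assms(8) by (auto simp: control_set_def)
  have umin: "norm (u t) = umin" if "t \<in> {0..tf}" "t \<notin> N" "\<Psi> t < 0" for t
    using swi[OF that(1,2), of umin] uN[OF that(1,2)] that(3) assms(8) by (auto simp: control_set_def)
  have "AE t in lebesgue_on ({0..<t1} \<union> {t2<..tf}). norm (u t) = umax"
    by (rule AE_lebesgue_onI[OF NN]) (use umax out t12 in auto)
  moreover have "AE t in lebesgue_on {t1..t2}. norm (u t) = umin" if "\<forall>t\<in>{t1..t2} - N'. \<Psi> t < 0"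
    by (rule AE_lebesgue_onI[OF NN]) (use umin that t12 in auto)
  ultimately show ?thesis using t12 ins by blast
qed

end
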